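(* Let $P_0\in\mathbb{C}[z]$ be a polynomial of degree $d\ge1$ and, for $j=0,1,\dots,d-1$, let $F_j(z)=\int_0^z t^je^{P_0(t)}\,dt$. Consider the $\mathbb{C}$-vector space of entire functions $$\mathbb{V}_{P_0}=\mathbb{C}[z]\,e^{P_0}\oplus\mathbb{C}\cdot1\oplus\mathbb{C}F_0\oplus\dots\oplus\mathbb{C}F_{d-2}=z\,\mathbb{C}[z]\,e^{P_0}\oplus\mathbb{C}\cdot1\oplus\mathbb{C}F_0\oplus\dots\oplus\mathbb{C}F_{d-1}.$$ For every $Q\in\mathbb{C}[z]$, the primitive $\int_0^zQ(t)e^{P_0(t)}\,dt$ belongs to $\mathbb{V}_{P_0}$. Conversely, every element of $\mathbb{V}_{P_0}$ vanishing at $0$ is of the form $\int_0^zQ(t)e^{P_0(t)}\,dt$ for some $Q\in\mathbb{C}[z]$. *)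

theory Defs
  imports
    "HOL-Complex_Analysis.Complex_Analysis"
    "HOL-Library.Function_Algebras"
    "HOL-Library.Set_Algebras"
begin

text \<open>Functions \<open>complex \<Rightarrow> complex\<close> carry pointwise addition and zero from
  \<open>Function_Algebras\<close>; sets of them are added elementwise via \<open>Set_Algebras\<close>.\<close>

definition fscale :: "complex \<Rightarrow> (complex \<Rightarrow> complex) \<Rightarrow> (complex \<Rightarrow> complex)" where
  "fscale c f = (\<lambda>z. c * f z)"

interpretation cfun: vector_space fscale
  by unfold_locales (auto simp: fscale_def fun_eq_iff algebra_simps)

text \<open>Internal direct sum of a finite list of subspaces: every element of \<open>V\<close> is a sum
  \<open>v\<^sub>1 + \<dots> + v\<^sub>n\<close> with \<open>v\<^sub>i \<in> U\<^sub>i\<close> for exactly one choice of the \<open>v\<^sub>i\<close>, and all such sums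
  lie in \<open>V\<close>. Here \<open>listset Us\<close> is the Cartesian product of the members of \<open>Us\<close>.\<close>

definition is_direct_sum ::
  "(complex \<Rightarrow> complex) set list \<Rightarrow> (complex \<Rightarrow> complex) set \<Rightarrow> bool" where
  "is_direct_sum Us V \<longleftrightarrow>
     (\<forall>U\<in>set Us. cfun.subspace U) \<and> bij_betw sum_list (listset Us) V"

definition prim :: "(complex \<Rightarrow> complex) \<Rightarrow> complex \<Rightarrow> complex" where
  "prim g z = contour_integral (linepath 0 z) g"

definition primF :: "complex poly \<Rightarrow> nat \<Rightarrow> complex \<Rightarrow> complex" where
  "primF P j = prim (\<lambda>t. t ^ j * exp (poly P t))"

definition poly_exp :: "complex poly \<Rightarrow> (complex \<Rightarrow> complex) set" where
  "poly_exp P = {\<lambda>z. poly Q z * exp (poly P z) | Q. True}"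

definition z_poly_exp :: "complex poly \<Rightarrow> (complex \<Rightarrow> complex) set" where
  "z_poly_exp P = {\<lambda>z. z * poly Q z * exp (poly P z) | Q. True}"

text \<open>Only the plain sum of the subspaces; directness is a property to be proved. Intended for
  \<open>degree P \<ge> 1\<close>; for degree 1 the last sum is empty, i.e. the zero subspace.\<close>

definition VP :: "complex poly \<Rightarrow> (complex \<Rightarrow> complex) set" where
  "VP P = poly_exp P + cfun.span {\<lambda>_. 1} + (\<Sum>j<degree P - 1. cfun.span {primF P j})"

end

theory Submission
  imports Defs
begin

text \<open>The idea is to differentiate. Since \<open>(A e\<^sup>P)' = (A' + A P') e\<^sup>P\<close>, the twisted derivative
  \<open>D A = A' + A P'\<close> describes differentiation of polynomial multiples of \<open>e\<^sup>P\<close> entirely inside the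
  polynomial ring, and integration turns a decomposition \<open>Q = D A + B\<close> into
  \<open>\<integral> Q e\<^sup>P = A e\<^sup>P + const + \<integral> B e\<^sup>P\<close>. If \<open>B\<close> has degree below \<open>n\<close>, the last integral is a
  combination of \<open>F\<^sub>0, \<dots>, F\<^bsub>n-1\<^esub>\<close>.

  For \<open>deg P = d \<ge> 1\<close> and \<open>A \<noteq> 0\<close> the operator raises the degree by exactly \<open>d - 1\<close>
  (\<open>degree_twisted_deriv\<close>). Thus reduction of the leading term writes every \<open>Q\<close> as \<open>D A + B\<close>
  with \<open>deg B < d - 1\<close>, to be read as \<open>B = 0\<close> if \<open>d = 1\<close> (\<open>twisted_deriv_division\<close>), and \<open>D A + B = 0\<close> with such a \<open>B\<close> forces
  \<open>A = B = 0\<close>. For multipliers \<open>A\<close> divisible by \<open>z\<close> the lost constant term is compensated by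
  one more basis integral: \<open>D\<close> of a constant is a multiple of \<open>P'\<close>, of degree \<open>d - 1\<close>, while
  \<open>D A\<close> has degree at least \<open>d\<close> for nonzero \<open>A\<close> divisible by \<open>z\<close>.

  Both decompositions therefore have the same total space, that of all functions
  \<open>c + \<integral>\<^sub>0\<^sup>z Q e\<^sup>P\<close>. In this description the space is visibly a space of entire functions, it
  contains all the primitives, and its elements vanishing at \<open>0\<close> are those with \<open>c = 0\<close>.\<close>

section \<open>Primitives of polynomial multiples of an exponential\<close>

abbreviation weighted :: "complex poly \<Rightarrow> complex poly \<Rightarrow> complex \<Rightarrow> complex" where
  "weighted P Q \<equiv> (\<lambda>z. poly Q z * exp (poly P z))"

abbreviation weighted_prim :: "complex poly \<Rightarrow> complex poly \<Rightarrow> complex \<Rightarrow> complex" where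
  "weighted_prim P Q \<equiv> prim (weighted P Q)"

definition prim_space :: "complex poly \<Rightarrow> (complex \<Rightarrow> complex) set" where
  "prim_space P = {\<lambda>z. c + weighted_prim P Q z | c Q. True}"

definition twisted_deriv :: "complex poly \<Rightarrow> complex poly \<Rightarrow> complex poly" where
  "twisted_deriv P A = pderiv A + A * pderiv P"

text \<open>The segment from \<open>0\<close> to \<open>z\<close> may be forgotten once an antiderivative is known, so all
  identities between primitives reduce to comparing derivatives.\<close>

lemma prim_eq_diff:
  assumes "\<And>z. (f has_field_derivative g z) (at z)"
  shows "prim g z = f z - f 0"
  unfolding prim_def
  using contour_integral_primitive[of UNIV f g "linepath 0 z"] assms
  by (intro contour_integral_unique) auto

lemma has_field_derivative_weighted_prim:
  "(weighted_prim P Q has_field_derivative weighted P Q z) (at z)"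
proof -
  have "weighted P Q holomorphic_on UNIV"
    by (intro holomorphic_intros)
  then obtain f where f: "\<And>z. (f has_field_derivative weighted P Q z) (at z)"
    using holomorphic_convex_primitive'[of UNIV "weighted P Q"] by auto
  have "weighted_prim P Q = (\<lambda>z. f z - f 0)"
    using prim_eq_diff[OF f] by (intro ext)
  then show ?thesis
    using DERIV_diff[OF f DERIV_const] by simp
qed

lemma prim_0 [simp]: "prim g 0 = 0"
  by (simp add: prim_def)

lemma weighted_prim_add:
  "weighted_prim P (Q + R) z = weighted_prim P Q z + weighted_prim P R z"
proof -
  have "((\<lambda>z. weighted_prim P Q z + weighted_prim P R z)
      has_field_derivative weighted P (Q + R) z) (at z)" for z
    by (rule derivative_eq_intros has_field_derivative_weighted_prim refl)+
       (simp add: algebra_simps)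
  from prim_eq_diff[OF this, of z] show ?thesis
    by simp
qed

lemma weighted_prim_smult: "weighted_prim P (smult c Q) z = c * weighted_prim P Q z"
proof -
  have "((\<lambda>z. c * weighted_prim P Q z) has_field_derivative weighted P (smult c Q) z) (at z)" for z
    by (rule derivative_eq_intros has_field_derivative_weighted_prim refl)+ simp
  from prim_eq_diff[OF this, of z] show ?thesis
    by simp
qed

lemma prim_zero_fun [simp]: "prim (\<lambda>_. 0) = (\<lambda>_. 0)"
  by (simp add: fun_eq_iff prim_def)

lemma weighted_prim_twisted_deriv:
  "weighted_prim P (twisted_deriv P A) z = weighted P A z - weighted P A 0"
proof -
  have "(weighted P A has_field_derivative weighted P (twisted_deriv P A) z) (at z)" for z
    by (rule derivative_eq_intros refl)+ (simp add: twisted_deriv_def algebra_simps)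
  then show ?thesis
    by (rule prim_eq_diff)
qed

lemma weighted_prim_plus_const_eq_0D:
  assumes "\<And>z. c + weighted_prim P Q z = 0"
  shows "Q = 0"
proof -
  have "((\<lambda>z. c + weighted_prim P Q z) has_field_derivative weighted P Q z) (at z)" for z
    by (rule derivative_eq_intros has_field_derivative_weighted_prim refl)+ simp
  moreover have "((\<lambda>z. c + weighted_prim P Q z) has_field_derivative 0) (at z)" for z
    using assms by simp
  ultimately have "weighted P Q z = 0" for z
    using DERIV_unique by blast
  then show ?thesis
    using poly_all_0_iff_0[of Q] by simp
qed

lemma sum_primF:
  "(\<Sum>j<n. fscale (b j) (primF P j)) = weighted_prim P (\<Sum>j<n. monom (b j) j)"
proof (induction n)
  case (Suc n)
  have "fscale (b n) (primF P n) = weighted_prim P (smult (b n) (monom 1 n))"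
    by (simp add: fun_eq_iff weighted_prim_smult fscale_def primF_def poly_monom del: poly_smult)
  then show ?case
    by (simp only: Suc.IH sum.lessThan_Suc)
       (simp add: fun_eq_iff weighted_prim_add smult_monom del: poly_add)
qed (simp add: zero_fun_def)

section \<open>Division by the twisted derivative\<close>

lemma twisted_deriv_add: "twisted_deriv P (A + B) = twisted_deriv P A + twisted_deriv P B"
  by (simp add: twisted_deriv_def pderiv_add algebra_simps)

lemma twisted_deriv_0 [simp]: "twisted_deriv P 0 = 0"
  by (simp add: twisted_deriv_def)

text \<open>In degree \<open>deg A + deg P - 1 \<ge> deg A\<close> only \<open>A P'\<close> contributes, since \<open>A'\<close> is zero or has
  smaller degree than \<open>A\<close>.\<close>

lemma coeff_twisted_deriv:
  assumes "degree P \<ge> 1"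
  shows "coeff (twisted_deriv P A) (degree A + (degree P - 1))
         = lead_coeff A * lead_coeff (pderiv P)"
proof -
  have "coeff (pderiv A) (degree A + (degree P - 1)) = 0"
    by (simp add: coeff_pderiv coeff_eq_0)
  then show ?thesis
    using coeff_mult_degree_sum[of A "pderiv P"]
    by (simp add: twisted_deriv_def degree_pderiv)
qed

lemma degree_twisted_deriv:
  assumes "degree P \<ge> 1" and "A \<noteq> 0"
  shows "degree (twisted_deriv P A) = degree A + (degree P - 1)"
proof (rule antisym)
  show "degree (twisted_deriv P A) \<le> degree A + (degree P - 1)"
    unfolding twisted_deriv_def
    by (intro degree_add_le)
       (auto simp: degree_pderiv intro: order.trans[OF degree_mult_le])
  have "pderiv P \<noteq> 0"
    using assms(1) by (simp add: pderiv_eq_0_iff)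
  then show "degree A + (degree P - 1) \<le> degree (twisted_deriv P A)"
    using assms(2) by (intro le_degree) (simp only: coeff_twisted_deriv[OF assms(1)], simp)
qed

text \<open>A leading term of degree at least \<open>d - 1\<close> is cancelled by the twisted derivative of a
  suitable monomial, after which the degree has dropped.\<close>

lemma twisted_deriv_division:
  assumes "degree P \<ge> 1"
  obtains A B where "Q = twisted_deriv P A + B" and "\<And>j. j \<ge> degree P - 1 \<Longrightarrow> coeff B j = 0"
proof -
  have "\<exists>A B. Q = twisted_deriv P A + B \<and> (\<forall>j\<ge>degree P - 1. coeff B j = 0)"
    if "\<forall>j\<ge>n. coeff Q j = 0" for n Q
    using that
  proof (induction n arbitrary: Q)
    case 0
    then have "Q = 0"
      by (simp add: poly_eq_iff)
    then show ?case
      by (intro exI[of _ 0]) simp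
  next
    case (Suc n)
    show ?case
    proof (cases "n < degree P - 1")
      case True
      then show ?thesis
        using Suc.prems by (intro exI[of _ 0] exI[of _ Q]) auto
    next
      case False
      define m where "m = n - (degree P - 1)"
      define M where "M = monom (coeff Q n / lead_coeff (pderiv P)) m"
      have lc: "lead_coeff (pderiv P) \<noteq> 0"
        using assms by (simp add: pderiv_eq_0_iff)
      have "coeff (Q - twisted_deriv P M) j = 0" if "j \<ge> n" for j
      proof (cases "coeff Q n = 0")
        case True
        then show ?thesis
          using Suc.prems that by (cases "j = n") (auto simp: M_def)
      next
        case nz: False
        have M: "M \<noteq> 0" "degree M + (degree P - 1) = n" "lead_coeff M = coeff Q n / lead_coeff (pderiv P)"
          using nz lc False by (auto simp: M_def m_def degree_monom_eq)
        show ?thesis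
        proof (cases "j = n")
          case True
          then show ?thesis
            using coeff_twisted_deriv[OF assms, of M] M lc by simp
        next
          case False
          then show ?thesis
            using Suc.prems that degree_twisted_deriv[OF assms M(1)] M(2)
            by (simp add: coeff_eq_0)
        qed
      qed
      then obtain A B where "Q - twisted_deriv P M = twisted_deriv P A + B"
        "\<forall>j\<ge>degree P - 1. coeff B j = 0"
        using Suc.IH by blast
      then show ?thesis
        by (intro exI[of _ "A + M"] exI[of _ B]) (auto simp: twisted_deriv_add algebra_simps)
    qed
  qed
  from this[of "Suc (degree Q)" Q] show ?thesis
    using that by (auto simp: coeff_eq_0)
qed

section \<open>Direct sums of lists of subspaces\<close>

lemma listset_conv_nth:
  "xs \<in> listset Us \<longleftrightarrow> length xs = length Us \<and> (\<forall>i<length Us. xs ! i \<in> Us ! i)"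
proof (induction Us arbitrary: xs)
  case (Cons U Us)
  then show ?case
    by (cases xs) (auto simp: set_Cons_def nth_Cons less_Suc_eq_0_disj split: nat.splits)
qed auto

lemma sum_list_image_listset: "sum_list ` listset Us = sum_list Us"
proof (induction Us)
  case Nil
  show ?case
    by (simp add: set_zero)
next
  case (Cons U Us)
  have "sum_list ` listset (U # Us) = U + sum_list ` listset Us"
    by (force simp: set_Cons_def set_plus_def)
  with Cons show ?case
    by simp
qed

text \<open>As for a linear map, injectivity is a matter of the kernel, because entrywise differences
  of two tuples of vectors stay in the product of the subspaces.\<close>

lemma inj_on_sum_list_listset:
  assumes sub: "\<And>U. U \<in> set Us \<Longrightarrow> cfun.subspace U"
    and ker: "\<And>vs. vs \<in> listset Us \<Longrightarrow> sum_list vs = 0 \<Longrightarrow> set vs \<subseteq> {0}"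
  shows "inj_on sum_list (listset Us)"
proof (rule inj_onI)
  fix vs ws
  assume vs: "vs \<in> listset Us" and ws: "ws \<in> listset Us" and eq: "sum_list vs = sum_list ws"
  define ds where "ds = map (\<lambda>i. vs ! i - ws ! i) [0..<length Us]"
  have len: "length vs = length Us" "length ws = length Us"
    using vs ws by (auto simp: listset_conv_nth)
  have "ds \<in> listset Us"
    using vs ws sub cfun.subspace_diff by (auto simp: ds_def listset_conv_nth)
  moreover have "sum_list ds = sum_list vs - sum_list ws"
    using len by (simp add: ds_def sum_list_subtractf)
       (metis map_nth)
  ultimately have "set ds \<subseteq> {0}"
    using ker eq by simp
  then have "vs ! i = ws ! i" if "i < length Us" for i
  proof -
    have "vs ! i - ws ! i \<in> set ds"
      using that by (auto simp: ds_def)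
    with \<open>set ds \<subseteq> {0}\<close> have "vs ! i - ws ! i = 0"
      by blast
    then show ?thesis
      by simp
  qed
  then show "vs = ws"
    using len by (auto intro: nth_equalityI)
qed

section \<open>The two decompositions\<close>

lemma subspace_prim_space: "cfun.subspace (prim_space P)"
proof (rule cfun.subspaceI)
  show "0 \<in> prim_space P"
  proof -
    have "0 = (\<lambda>z. 0 + weighted_prim P 0 z)"
      by (simp add: fun_eq_iff)
    then show ?thesis
      unfolding prim_space_def by blast
  qed
next
  fix f g
  assume "f \<in> prim_space P" "g \<in> prim_space P"
  then obtain a b Q R where "f = (\<lambda>z. a + weighted_prim P Q z)" "g = (\<lambda>z. b + weighted_prim P R z)"
    by (auto simp: prim_space_def)
  then have "f + g = (\<lambda>z. (a + b) + weighted_prim P (Q + R) z)"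
    by (simp add: fun_eq_iff weighted_prim_add del: poly_add)
  then show "f + g \<in> prim_space P"
    unfolding prim_space_def by blast
next
  fix c f
  assume "f \<in> prim_space P"
  then obtain a Q where "f = (\<lambda>z. a + weighted_prim P Q z)"
    by (auto simp: prim_space_def)
  then have "fscale c f = (\<lambda>z. c * a + weighted_prim P (smult c Q) z)"
    by (simp add: fun_eq_iff fscale_def weighted_prim_smult distrib_left del: poly_smult)
  then show "fscale c f \<in> prim_space P"
    unfolding prim_space_def by blast
qed

lemma span_const: "cfun.span {\<lambda>_. 1} = {\<lambda>_. c | c. True}"
  by (auto simp: cfun.span_singleton fscale_def)

lemma sum_span_singleton:
  fixes n :: nat
  shows "(\<Sum>j<n. cfun.span {F j}) = {\<Sum>j<n. fscale (b j) (F j) | b. True}"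
proof -
  have "(\<Sum>j<n. cfun.span {F j}) = {\<Sum>j<n. v j | v. \<forall>j<n. v j \<in> range (\<lambda>k. fscale k (F j))}"
    by (subst set_sum_alt) (auto simp: cfun.span_singleton)
  also have "\<dots> = {\<Sum>j<n. fscale (b j) (F j) | b. True}"
  proof safe
    fix v assume "\<forall>j<n. v j \<in> range (\<lambda>k. fscale k (F j))"
    then have "\<forall>j<n. \<exists>k. v j = fscale k (F j)"
      by blast
    then obtain b where "\<forall>j<n. v j = fscale (b j) (F j)"
      by metis
    then show "\<exists>b. sum v {..<n} = (\<Sum>j<n. fscale (b j) (F j)) \<and> True"
      by (intro exI[of _ b]) (auto intro: sum.cong)
  qed blast
  finally show ?thesis .
qed

lemma poly_eq_sum_monom:
  assumes "\<And>j. j \<ge> n \<Longrightarrow> coeff B j = 0"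
  shows "B = (\<Sum>j<n. monom (coeff B j) j)"
  using assms by (auto simp: poly_eq_iff coeff_sum if_distrib not_less cong: if_cong)

text \<open>Both decompositions are instances, with \<open>U\<close> the space of all multiples of \<open>e\<^sup>P\<close> and
  \<open>n = d - 1\<close>, or \<open>U\<close> the space of multiples by polynomials vanishing at \<open>0\<close> and \<open>n = d\<close>. Since
  \<open>A e\<^sup>P\<close> is a constant plus a primitive of \<open>D A e\<^sup>P\<close>, the sum consists of primitives, and division
  by \<open>D\<close> gives the converse.\<close>

lemma sum_subspaces_eq_prim_space:
  assumes weighted: "\<And>u. u \<in> U \<Longrightarrow> \<exists>A. u = weighted P A"
    and division: "\<And>Q. \<exists>A B. weighted P A \<in> U \<and> Q = twisted_deriv P A + B
                        \<and> (\<forall>j\<ge>n. coeff B j = 0)"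
  shows "U + cfun.span {\<lambda>_. 1} + (\<Sum>j<n. cfun.span {primF P j}) = prim_space P"
proof (intro equalityI subsetI)
  fix f
  assume "f \<in> U + cfun.span {\<lambda>_. 1} + (\<Sum>j<n. cfun.span {primF P j})"
  then obtain A c b where
    "f = weighted P A + (\<lambda>_. c) + weighted_prim P (\<Sum>j<n. monom (b j) j)"
    unfolding span_const sum_span_singleton sum_primF
    by (fastforce elim!: set_plus_elim dest: weighted)
  then have "f = (\<lambda>z. (c + weighted P A 0)
      + weighted_prim P (twisted_deriv P A + (\<Sum>j<n. monom (b j) j)) z)"
    by (simp add: fun_eq_iff weighted_prim_add weighted_prim_twisted_deriv del: poly_add)
  then show "f \<in> prim_space P"
    unfolding prim_space_def by blast
next
  fix f
  assume "f \<in> prim_space P"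
  then obtain c Q where f: "f = (\<lambda>z. c + weighted_prim P Q z)"
    by (auto simp: prim_space_def)
  obtain A B where A: "weighted P A \<in> U" and Q: "Q = twisted_deriv P A + B"
    and B: "\<And>j. j \<ge> n \<Longrightarrow> coeff B j = 0"
    using division by blast
  have "f = weighted P A + (\<lambda>_. c - weighted P A 0) + weighted_prim P B"
    by (simp add: f Q fun_eq_iff weighted_prim_add weighted_prim_twisted_deriv del: poly_add)
  moreover have "weighted_prim P B \<in> (\<Sum>j<n. cfun.span {primF P j})"
  proof -
    have "B = (\<Sum>j<n. monom (coeff B j) j)"
      using B by (rule poly_eq_sum_monom)
    then have "weighted_prim P B = weighted_prim P (\<Sum>j<n. monom (coeff B j) j)"
      by (rule arg_cong)
    then show ?thesis
      unfolding sum_span_singleton sum_primF by (intro CollectI exI conjI TrueI)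
  qed
  ultimately show "f \<in> U + cfun.span {\<lambda>_. 1} + (\<Sum>j<n. cfun.span {primF P j})"
    using A by (auto simp: span_const)
qed

text \<open>A vanishing sum differentiates to \<open>D A + B = 0\<close> with \<open>deg B < n\<close>, and the bound on the
  degree of \<open>A\<close> makes the leading term of \<open>D A\<close> impossible to cancel by \<open>B\<close>.\<close>

lemma is_direct_sum_prim_space:
  assumes deg: "degree P \<ge> 1"
    and sub: "cfun.subspace U"
    and weighted: "\<And>u. u \<in> U \<Longrightarrow> \<exists>A. u = weighted P A \<and> (A = 0 \<or> n \<le> degree A + (degree P - 1))"
    and division: "\<And>Q. \<exists>A B. weighted P A \<in> U \<and> Q = twisted_deriv P A + B
                        \<and> (\<forall>j\<ge>n. coeff B j = 0)"
  shows "is_direct_sum ([U, cfun.span {\<lambda>_. 1}] @ map (\<lambda>j. cfun.span {primF P j}) [0..<n])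
           (prim_space P)" (is "is_direct_sum ?Us _")
proof -
  have subspaces: "cfun.subspace V" if "V \<in> set ?Us" for V
    using that sub by auto
  have "set vs \<subseteq> {0}" if vs: "vs \<in> listset ?Us" and sum0: "sum_list vs = 0" for vs
  proof -
    obtain u k ws where vs_eq: "vs = u # k # ws" and "u \<in> U" "k \<in> cfun.span {\<lambda>_. 1}"
      and ws: "ws \<in> listset (map (\<lambda>j. cfun.span {primF P j}) [0..<n])"
      using vs by (auto simp: set_Cons_def)
    obtain A where u: "u = weighted P A" and A: "A = 0 \<or> n \<le> degree A + (degree P - 1)"
      using weighted \<open>u \<in> U\<close> by blast
    obtain c where k: "k = (\<lambda>_. c)"
      using \<open>k \<in> cfun.span {\<lambda>_. 1}\<close> by (auto simp: span_const)
    have len: "length ws = n" and "\<forall>j<n. \<exists>b. ws ! j = fscale b (primF P j)"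
      using ws by (auto simp: listset_conv_nth cfun.span_singleton)
    then obtain b where b: "\<And>j. j < n \<Longrightarrow> ws ! j = fscale (b j) (primF P j)"
      by metis
    define B where "B = (\<Sum>j<n. monom (b j) j)"
    have coeff_B: "coeff B j = (if j < n then b j else 0)" for j
      by (simp add: B_def coeff_sum if_distrib cong: if_cong)
    have "sum_list ws = (\<Sum>j<n. fscale (b j) (primF P j))"
      using len b by (simp add: sum_list_sum_nth atLeast0LessThan)
    then have "u + (k + weighted_prim P B) = 0"
      using sum0 by (simp add: vs_eq sum_primF B_def)
    then have z: "weighted P A z + (c + weighted_prim P B z) = 0" for z
      by (simp add: u k fun_eq_iff)
    have "(c + weighted P A 0) + weighted_prim P (twisted_deriv P A + B) z = 0" for z
      using z[of z] by (simp only: weighted_prim_add weighted_prim_twisted_deriv)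
        (simp add: algebra_simps)
    then have "twisted_deriv P A + B = 0"
      by (rule weighted_prim_plus_const_eq_0D)
    moreover have "A = 0"
    proof (rule ccontr)
      assume "A \<noteq> 0"
      moreover from this have "coeff B (degree A + (degree P - 1)) = 0"
        using A by (simp add: coeff_B)
      moreover have "pderiv P \<noteq> 0"
        using deg by (simp add: pderiv_eq_0_iff)
      ultimately have "coeff (twisted_deriv P A + B) (degree A + (degree P - 1)) \<noteq> 0"
        by (simp only: coeff_add coeff_twisted_deriv[OF deg]) simp
      with \<open>twisted_deriv P A + B = 0\<close> show False
        by simp
    qed
    ultimately have "B = 0"
      by simp
    have "c = 0"
      using z[of 0] \<open>A = 0\<close> by simp
    moreover have "ws ! j = 0" if "j < n" for j
      using coeff_B[of j] b[OF that] \<open>B = 0\<close> that by (simp add: fscale_def fun_eq_iff)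
    ultimately show ?thesis
      using \<open>A = 0\<close> len by (auto simp: vs_eq u k fun_eq_iff in_set_conv_nth)
  qed
  then have "inj_on sum_list (listset ?Us)"
    using subspaces inj_on_sum_list_listset by blast
  moreover have "sum_list ` listset ?Us
      = U + cfun.span {\<lambda>_. 1} + (\<Sum>j<n. cfun.span {primF P j})"
    by (simp only: sum_list_image_listset)
       (simp add: interv_sum_list_conv_sum_set_nat atLeast0LessThan add.assoc)
  then have "sum_list ` listset ?Us = prim_space P"
    using sum_subspaces_eq_prim_space[of U P n] weighted division by metis
  ultimately show ?thesis
    using subspaces by (simp only: is_direct_sum_def bij_betw_def) blast
qed

lemma subspace_poly_exp: "cfun.subspace (poly_exp P)"
proof (rule cfun.subspaceI)
  show "0 \<in> poly_exp P"
  proof -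
    have "0 = weighted P 0"
      by (simp add: fun_eq_iff)
    then show ?thesis
      unfolding poly_exp_def by blast
  qed
next
  fix f g
  assume "f \<in> poly_exp P" "g \<in> poly_exp P"
  then obtain Q R where "f = weighted P Q" "g = weighted P R"
    by (auto simp: poly_exp_def)
  then have "f + g = weighted P (Q + R)"
    by (simp add: fun_eq_iff distrib_right)
  then show "f + g \<in> poly_exp P"
    unfolding poly_exp_def by blast
next
  fix c f
  assume "f \<in> poly_exp P"
  then obtain Q where "f = weighted P Q"
    by (auto simp: poly_exp_def)
  then have "fscale c f = weighted P (smult c Q)"
    by (simp add: fun_eq_iff fscale_def)
  then show "fscale c f \<in> poly_exp P"
    unfolding poly_exp_def by blast
qed

lemma z_poly_exp_conv: "z_poly_exp P = {weighted P (pCons 0 Q) | Q. True}"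
  by (simp add: z_poly_exp_def)

lemma subspace_z_poly_exp: "cfun.subspace (z_poly_exp P)"
proof (rule cfun.subspaceI)
  show "0 \<in> z_poly_exp P"
  proof -
    have "0 = weighted P (pCons 0 0)"
      by (simp add: fun_eq_iff)
    then show ?thesis
      unfolding z_poly_exp_conv by blast
  qed
next
  fix f g
  assume "f \<in> z_poly_exp P" "g \<in> z_poly_exp P"
  then obtain Q R where "f = weighted P (pCons 0 Q)" "g = weighted P (pCons 0 R)"
    by (auto simp: z_poly_exp_conv simp del: poly_pCons)
  then have "f + g = weighted P (pCons 0 (Q + R))"
    by (simp add: fun_eq_iff algebra_simps)
  then show "f + g \<in> z_poly_exp P"
    unfolding z_poly_exp_conv by blast
next
  fix c f
  assume "f \<in> z_poly_exp P"
  then obtain Q where "f = weighted P (pCons 0 Q)"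
    by (auto simp: z_poly_exp_conv simp del: poly_pCons)
  then have "fscale c f = weighted P (pCons 0 (smult c Q))"
    by (simp add: fun_eq_iff fscale_def)
  then show "fscale c f \<in> z_poly_exp P"
    unfolding z_poly_exp_conv by blast
qed

lemma division_poly_exp:
  assumes "degree P \<ge> 1"
  shows "\<exists>A B. weighted P A \<in> poly_exp P \<and> Q = twisted_deriv P A + B
          \<and> (\<forall>j\<ge>degree P - 1. coeff B j = 0)"
proof -
  obtain A B where "Q = twisted_deriv P A + B" "\<And>j. j \<ge> degree P - 1 \<Longrightarrow> coeff B j = 0"
    using twisted_deriv_division[OF assms] by metis
  then show ?thesis
    unfolding poly_exp_def by blast
qed

text \<open>Relative to the division for arbitrary \<open>A\<close>, the constant term \<open>a\<close> of \<open>A\<close> is moved into the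
  remainder, where it contributes \<open>a P'\<close>.\<close>

lemma division_z_poly_exp:
  assumes "degree P \<ge> 1"
  shows "\<exists>A B. weighted P A \<in> z_poly_exp P \<and> Q = twisted_deriv P A + B
          \<and> (\<forall>j\<ge>degree P. coeff B j = 0)"
proof -
  obtain A B where Q: "Q = twisted_deriv P A + B" and B: "\<And>j. j \<ge> degree P - 1 \<Longrightarrow> coeff B j = 0"
    using twisted_deriv_division[OF assms] by metis
  obtain a A' where A: "A = pCons a A'"
    by (rule pCons_cases)
  have "A = pCons 0 A' + [:a:]"
    by (simp add: A)
  then have "Q = twisted_deriv P (pCons 0 A') + (smult a (pderiv P) + B)"
    by (simp only: Q twisted_deriv_add) (simp add: twisted_deriv_def pderiv_pCons)
  moreover have "coeff (smult a (pderiv P) + B) j = 0" if "j \<ge> degree P" for j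
    using that B by (simp add: coeff_pderiv coeff_eq_0)
  ultimately show ?thesis
    unfolding z_poly_exp_conv by blast
qed

theorem mainTheorem8:
  fixes P0 :: "complex poly" and d :: nat
  assumes "degree P0 = d" and "d \<ge> 1"
  shows "cfun.subspace (VP P0) \<and> (\<forall>f\<in>VP P0. f holomorphic_on UNIV)
    \<and> is_direct_sum ([poly_exp P0, cfun.span {\<lambda>_. 1}]
         @ map (\<lambda>j. cfun.span {primF P0 j}) [0..<d - 1]) (VP P0)
    \<and> is_direct_sum ([z_poly_exp P0, cfun.span {\<lambda>_. 1}]
         @ map (\<lambda>j. cfun.span {primF P0 j}) [0..<d]) (VP P0)
    \<and> (\<forall>Q :: complex poly. prim (\<lambda>t. poly Q t * exp (poly P0 t)) \<in> VP P0)
    \<and> (\<forall>f\<in>VP P0. f 0 = 0 \<longrightarrow>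
         (\<exists>Q :: complex poly. f = prim (\<lambda>t. poly Q t * exp (poly P0 t))))"
proof -
  have deg: "degree P0 \<ge> 1"
    using assms by simp
  have VP: "VP P0 = prim_space P0"
    unfolding VP_def
    by (rule sum_subspaces_eq_prim_space[OF _ division_poly_exp[OF deg]]) (auto simp: poly_exp_def)
  have "f holomorphic_on UNIV" if "f \<in> prim_space P0" for f
  proof -
    have "weighted_prim P0 Q holomorphic_on UNIV" for Q
      using has_field_derivative_weighted_prim holomorphic_on_open by blast
    then show ?thesis
      using that by (auto simp: prim_space_def intro!: holomorphic_intros)
  qed
  moreover have "is_direct_sum ([poly_exp P0, cfun.span {\<lambda>_. 1}]
         @ map (\<lambda>j. cfun.span {primF P0 j}) [0..<d - 1]) (prim_space P0)"
    using division_poly_exp[OF deg] assms(1)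
    by (intro is_direct_sum_prim_space[OF deg subspace_poly_exp]) (auto simp: poly_exp_def)
  moreover have "is_direct_sum ([z_poly_exp P0, cfun.span {\<lambda>_. 1}]
         @ map (\<lambda>j. cfun.span {primF P0 j}) [0..<d]) (prim_space P0)"
  proof (rule is_direct_sum_prim_space[OF deg subspace_z_poly_exp])
    fix u assume "u \<in> z_poly_exp P0"
    then obtain Q where "u = weighted P0 (pCons 0 Q)"
      by (auto simp: z_poly_exp_conv simp del: poly_pCons)
    then show "\<exists>A. u = weighted P0 A \<and> (A = 0 \<or> d \<le> degree A + (degree P0 - 1))"
      using assms by (intro exI[of _ "pCons 0 Q"]) (auto simp: degree_pCons_eq_if)
  qed (use division_z_poly_exp[OF deg] assms(1) in simp)
  moreover have "weighted_prim P0 Q \<in> prim_space P0" for Q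
  proof -
    have "weighted_prim P0 Q = (\<lambda>z. 0 + weighted_prim P0 Q z)"
      by simp
    then show ?thesis
      unfolding prim_space_def by blast
  qed
  moreover have "\<exists>Q. f = weighted_prim P0 Q" if "f \<in> prim_space P0" "f 0 = 0" for f
  proof -
    obtain c Q where f: "f = (\<lambda>z. c + weighted_prim P0 Q z)"
      using \<open>f \<in> prim_space P0\<close> by (auto simp: prim_space_def)
    with \<open>f 0 = 0\<close> have "c = 0"
      by simp
    with f show ?thesis
      by auto
  qed
  ultimately show ?thesis
    using subspace_prim_space unfolding VP by blast
qed

end
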